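(* Let $n$ be a positive odd integer, let $\ell$ be a positive integer, and let $m=(n-1)/2$. Let $\mathbf{A}_n$ be the $n\times n$ matrix, with rows and columns indexed by $0,1,\dots,n-1$, whose entries are $(\mathbf{A}_n)_{i,j}=ni+j+1$. Then for every rotation orbit $\{(i,j),\,(j,n-1-i),\,(n-1-i,n-1-j),\,(n-1-j,i)\}$ of index pairs (with $0\le i,j\le n-1$), the sum of the four corresponding entries of the matrix power $\mathbf{A}_n^\ell$ equals four times its center entry: $$(\mathbf{A}_n^\ell)_{i,j}+(\mathbf{A}_n^\ell)_{j,\,n-1-i}+(\mathbf{A}_n^\ell)_{n-1-i,\,n-1-j}+(\mathbf{A}_n^\ell)_{n-1-j,\,i}=4\,(\mathbf{A}_n^\ell)_{m,m}.$$
   Context: The quarter-turn rotation of the index grid $\{0,\dots,n-1\}^2$ is the map $\rho(i,j)=(j,\,n-1-i)$, which satisfies $\rho^4=\mathrm{id}$. For $n$ odd, its unique fixed point is the center $(m,m)$ with $m=(n-1)/2$. A rotation orbit is the orbit under $\rho$ of an index pair $(i,j)\neq(m,m)$; it consists of the four distinct positions $(i,j),\,(j,n-1-i),\,(n-1-i,n-1-j),\,(n-1-j,i)$. The center entry of an $n\times n$ matrix with $n$ odd is the entry at position $(m,m)$. $\mathbf{A}_n^\ell$ is the $\ell$-th power under ordinary matrix multiplication. *)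

theory Defs
  imports "Jordan_Normal_Form.Matrix" "HOL-Combinatorics.Orbits"
begin

definition consecutive_mat :: "nat \<Rightarrow> int mat" where
  "consecutive_mat n = mat n n (\<lambda>(i, j). int (n * i + j + 1))"

text \<open>Only meant for \<open>i < n\<close>, where the truncated subtraction is exact.\<close>

definition quarter_turn :: "nat \<Rightarrow> nat \<times> nat \<Rightarrow> nat \<times> nat" where
  "quarter_turn n = (\<lambda>(i, j). (j, n - 1 - i))"

text \<open>
  The library's \<open>orbit f x\<close> collects the positive iterates of \<open>f\<close> at \<open>x\<close>; as the
  quarter turn has order 4 on the grid, \<open>x\<close> itself is included. For odd \<open>n\<close> the
  excluded pair is the centre of the grid.
\<close>

definition rotation_orbits :: "nat \<Rightarrow> (nat \<times> nat) set set" where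
  "rotation_orbits n =
     orbit (quarter_turn n) ` ({..<n} \<times> {..<n} - {((n - 1) div 2, (n - 1) div 2)})"

lemma orbit_quarter_turn:
  assumes "i < n" "j < n"
  shows "orbit (quarter_turn n) (i, j) =
    {(i, j), (j, n - 1 - i), (n - 1 - i, n - 1 - j), (n - 1 - j, i)}" (is "_ = ?S")
proof
  show "orbit (quarter_turn n) (i, j) \<subseteq> ?S"
  proof
    fix p assume "p \<in> orbit (quarter_turn n) (i, j)"
    then show "p \<in> ?S"
      by induction (use assms in \<open>auto simp: quarter_turn_def\<close>)
  qed
  have 1: "(j, n - 1 - i) \<in> orbit (quarter_turn n) (i, j)"
    using orbit.base[of "quarter_turn n" "(i, j)"] by (simp add: quarter_turn_def)
  have 2: "(n - 1 - i, n - 1 - j) \<in> orbit (quarter_turn n) (i, j)"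
    using orbit.step[OF 1] by (simp add: quarter_turn_def)
  have 3: "(n - 1 - j, i) \<in> orbit (quarter_turn n) (i, j)"
    using orbit.step[OF 2] assms by (simp add: quarter_turn_def)
  have 4: "(i, j) \<in> orbit (quarter_turn n) (i, j)"
    using orbit.step[OF 3] assms by (simp add: quarter_turn_def)
  show "?S \<subseteq> orbit (quarter_turn n) (i, j)"
    using 1 2 3 4 by blast
qed

lemma rotation_orbitsI:
  assumes "i < n" "j < n" "(i, j) \<noteq> ((n - 1) div 2, (n - 1) div 2)"
  shows "{(i, j), (j, n - 1 - i), (n - 1 - i, n - 1 - j), (n - 1 - j, i)} \<in> rotation_orbits n"
  unfolding rotation_orbits_def orbit_quarter_turn[OF assms(1,2), symmetric]
  using assms by (intro imageI) simp

end

theory Submission imports Defs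
begin

text \<open>
  Measure indices from the centre: put \<open>x\<^sub>i = i - m\<close>. The entries of the consecutive matrix
  are then \<open>c + n x\<^sub>i + x\<^sub>j\<close> for a constant \<open>c\<close>, a special case of a biaffine function
  \<open>a + b x\<^sub>i + c x\<^sub>j + d x\<^sub>i x\<^sub>j\<close>. Matrices with biaffine entries are exactly those of the form
  \<open>U K U\<^sup>T\<close>, where the two columns of \<open>U\<close> are the all-ones vector and \<open>x\<close>, so they are closed
  under multiplication (\<open>biaffine_mat_mult\<close>), and every positive power of the consecutive
  matrix is biaffine.

  A quarter turn sends \<open>(x\<^sub>i, x\<^sub>j)\<close> to \<open>(x\<^sub>j, - x\<^sub>i)\<close>. Along an orbit each of the functions
  \<open>x\<^sub>i\<close>, \<open>x\<^sub>j\<close> and \<open>x\<^sub>i x\<^sub>j\<close> sums to zero, so the orbit sum of a biaffine function is \<open>4 a\<close>,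
  and \<open>a\<close> is its value at the centre, where both coordinates vanish.
\<close>

definition biaffine_mat :: "nat \<Rightarrow> (nat \<Rightarrow> 'a :: comm_ring_1) \<Rightarrow> 'a mat \<Rightarrow> bool" where
  "biaffine_mat n x A \<longleftrightarrow> A \<in> carrier_mat n n \<and>
     (\<exists>a b c d. \<forall>i<n. \<forall>j<n. A $$ (i, j) = a + b * x i + c * x j + d * x i * x j)"

text \<open>
  In the entry sum of the product, the left factor contributes only affine dependence on the
  row coordinate and the right factor only affine dependence on the column coordinate; what
  remains of the summation index is absorbed into four constants.
\<close>

lemma biaffine_mat_mult:
  assumes "biaffine_mat n x A" "biaffine_mat n x B"
  shows "biaffine_mat n x (A * B)"
proof -
  have car: "A \<in> carrier_mat n n" "B \<in> carrier_mat n n"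
    using assms by (auto simp: biaffine_mat_def)
  obtain a b c d where A:
    "\<And>i j. i < n \<Longrightarrow> j < n \<Longrightarrow> A $$ (i, j) = a + b * x i + c * x j + d * x i * x j"
    using assms(1) unfolding biaffine_mat_def by blast
  obtain a' b' c' d' where B:
    "\<And>i j. i < n \<Longrightarrow> j < n \<Longrightarrow> B $$ (i, j) = a' + b' * x i + c' * x j + d' * x i * x j"
    using assms(2) unfolding biaffine_mat_def by blast
  define p q r s where "p k = a + c * x k" and "q k = b + d * x k"
    and "r k = a' + b' * x k" and "s k = c' + d' * x k" for k
  have "(A * B) $$ (i, j) = (\<Sum>k<n. p k * r k) + (\<Sum>k<n. q k * r k) * x i
      + (\<Sum>k<n. p k * s k) * x j + (\<Sum>k<n. q k * s k) * x i * x j"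
    if "i < n" "j < n" for i j
  proof -
    have "(A * B) $$ (i, j) = (\<Sum>k<n. A $$ (i, k) * B $$ (k, j))"
      using car that by (simp add: scalar_prod_def atLeast0LessThan)
    also have "\<dots> = (\<Sum>k<n. p k * r k + q k * r k * x i + p k * s k * x j + q k * s k * x i * x j)"
      using that by (intro sum.cong) (auto simp: A B p_def q_def r_def s_def algebra_simps)
    finally show ?thesis
      by (simp add: sum.distrib sum_distrib_right)
  qed
  then show ?thesis
    using car unfolding biaffine_mat_def by auto
qed

text \<open>
  The exponent must be positive: the identity matrix is not biaffine in general.
\<close>

lemma biaffine_mat_pow:
  assumes "biaffine_mat n x A" "l > 0"
  shows "biaffine_mat n x (A ^\<^sub>m l)"
  using assms(2)
proof (induction l rule: nat_induct_non_zero)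
  case 1
  have "A \<in> carrier_mat n n"
    using assms(1) by (simp add: biaffine_mat_def)
  then show ?case
    using assms(1) by simp
next
  case (Suc l)
  then show ?case
    using assms(1) by (simp add: biaffine_mat_mult)
qed

text \<open>
  This holds for any choice of the origin \<open>m\<close>, since a shift of the coordinate only changes
  the constant term.
\<close>

lemma biaffine_consecutive_mat:
  "biaffine_mat n (\<lambda>i. int i - int m) (consecutive_mat n)"
proof -
  have "consecutive_mat n $$ (i, j) = (int n * int m + int m + 1) + int n * (int i - int m)
      + 1 * (int j - int m) + 0 * (int i - int m) * (int j - int m)"
    if "i < n" "j < n" for i j
    using that by (simp add: consecutive_mat_def algebra_simps)
  moreover have "consecutive_mat n \<in> carrier_mat n n"
    by (simp add: consecutive_mat_def)
  ultimately show ?thesis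
    unfolding biaffine_mat_def by blast
qed

lemma biaffine_mat_rotation_sum:
  assumes "biaffine_mat n x A" "i < n" "j < n" "m < n"
    and centre: "x m = 0" and odd: "\<And>k. k < n \<Longrightarrow> x (n - 1 - k) = - x k"
  shows "A $$ (i, j) + A $$ (j, n - 1 - i) + A $$ (n - 1 - i, n - 1 - j) + A $$ (n - 1 - j, i)
    = 4 * A $$ (m, m)"
proof -
  obtain a b c d where A:
    "\<And>i j. i < n \<Longrightarrow> j < n \<Longrightarrow> A $$ (i, j) = a + b * x i + c * x j + d * x i * x j"
    using assms(1) unfolding biaffine_mat_def by blast
  have "n - 1 - i < n" "n - 1 - j < n"
    using assms by auto
  then show ?thesis
    using assms(2-4) by (simp only: A odd centre) (simp add: algebra_simps)
qed

theorem theorem1: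
  fixes n l m i j :: nat
  assumes "odd n" and "l > 0" and "m = (n - 1) div 2"
    and "i < n" and "j < n"
    and "{(i, j), (j, n - 1 - i), (n - 1 - i, n - 1 - j), (n - 1 - j, i)} \<in> rotation_orbits n"
  shows "(consecutive_mat n ^\<^sub>m l) $$ (i, j)
       + (consecutive_mat n ^\<^sub>m l) $$ (j, n - 1 - i)
       + (consecutive_mat n ^\<^sub>m l) $$ (n - 1 - i, n - 1 - j)
       + (consecutive_mat n ^\<^sub>m l) $$ (n - 1 - j, i)
       = 4 * (consecutive_mat n ^\<^sub>m l) $$ (m, m)"
proof (rule biaffine_mat_rotation_sum[where x = "\<lambda>k. int k - int m"])
  show "biaffine_mat n (\<lambda>k. int k - int m) (consecutive_mat n ^\<^sub>m l)"
    using biaffine_consecutive_mat \<open>l > 0\<close> by (rule biaffine_mat_pow)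
  have n: "n = 2 * m + 1"
    using assms by (auto elim: oddE)
  then show "m < n"
    by simp
  show "int (n - 1 - k) - int m = - (int k - int m)" if "k < n" for k
    using n that by (simp add: of_nat_diff)
qed (use assms in auto)

end
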